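(* Suppose $\phi(x)=\max_{y_1\in Y_1}\{d_{l1}^\top y_1+\varphi(x,y_1)\}$ is quasi-submodular, i.e. for every $y_1\in Y_1$ the function $x\mapsto\varphi(x,y_1)$ is submodular on $\{0,1\}^{n_x}$. Let $z\in\{0,1\}^{n_x}$, let $\hat y_1\in\arg\max_{y_1\in Y_1}\{d_{l1}^\top y_1+\varphi(z,y_1)\}$, let $\sigma$ be a permutation of $[n_x]$ such that $z_{\sigma_1}\ge z_{\sigma_2}\ge\cdots\ge z_{\sigma_{n_x}}$, and let $\mathcal S_k:=\{\sigma_1,\ldots,\sigma_k\}$, $\mathcal S_0:=\emptyset$. Then the inequality $$d_\ell^\top y\ge d_{l1}^\top\hat y_1+\varphi(\mathcal S_0,\hat y_1)+\sum_{k=1}^{n_x}\big[\varphi(\mathcal S_k,\hat y_1)-\varphi(\mathcal S_{k-1},\hat y_1)\big]x_{\sigma_k}$$ is valid and tight for $d_\ell^\top y\ge\phi(x)$, i.e. its right-hand side is at most $\phi(x)$ for all $x\in\{0,1\}^{n_x}$, with equality for some $x\in\{0,1\}^{n_x}$.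
   Context: The lower-level variable splits as $y=(y_1,y_2)\in Y=Y_1\times Y_2$, $Y_1\subseteq\mathbb{R}^{n_{y_1}}$ the domain of the integer lower-level variables, $Y_2\subseteq\mathbb{R}^{n_{y_2}}$; correspondingly $d_\ell=(d_{l1},d_{l2})$ and $B_\ell=[B_{l1},B_{l2}]$, and $A_\ell,h_\ell$ are real data of compatible dimensions. For $x\in\{0,1\}^{n_x}$, $y_1\in Y_1$, $$\varphi(x,y_1)=\max\{d_{l2}^\top y_2 : y_2\in Y_2,\ B_{l2}y_2\le h_\ell-A_\ell x-B_{l1}y_1\},$$ real-valued, and the maximum defining $\phi(x)\in\mathbb{R}$ is attained. For a set $\mathcal S\subseteq[n_x]=\{1,\dots,n_x\}$, $\varphi(\mathcal S,y_1):=\varphi(s,y_1)$ where $s\in\{0,1\}^{n_x}$ is the indicator vector of $\mathcal S$. A function $f:\{0,1\}^{n}\to\mathbb{R}$ is submodular if $f(x')+f(x'')\ge f(x'\vee x'')+f(x'\wedge x'')$ for all $x',x''$ (entrywise max/min). *)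

theory Defs
  imports "HOL-Analysis.Analysis"
begin

definition binary_cube :: "(real ^ 'n) set" where
  "binary_cube = {x. \<forall>i. x $ i \<in> {0, 1}}"

definition ind_vec :: "'n set \<Rightarrow> real ^ 'n" where
  "ind_vec S = (\<chi> i. if i \<in> S then 1 else 0)"

text \<open>The lattice operations on \<open>real ^ 'n\<close> are the entrywise maximum and minimum, and
  the order \<open>\<le>\<close> is entrywise.\<close>

definition submodular :: "(real ^ 'n \<Rightarrow> real) \<Rightarrow> bool" where
  "submodular f \<longleftrightarrow>
     (\<forall>x\<in>binary_cube. \<forall>x'\<in>binary_cube. f x + f x' \<ge> f (sup x x') + f (inf x x'))"

definition feasible2 ::
  "real ^ 'n ^ 'm \<Rightarrow> real ^ 'p ^ 'm \<Rightarrow> real ^ 'q ^ 'm \<Rightarrow> real ^ 'm \<Rightarrow> (real ^ 'q) set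
    \<Rightarrow> real ^ 'n \<Rightarrow> real ^ 'p \<Rightarrow> (real ^ 'q) set" where
  "feasible2 A B1 B2 h Y2 x y1 = {y2 \<in> Y2. B2 *v y2 \<le> h - A *v x - B1 *v y1}"

text \<open>\<open>GREATEST\<close> is the maximum of a possibly infinite set. It is meaningful only if the maximum
  is attained, which has to be assumed where \<open>varphi\<close> and \<open>phi\<close> are used.\<close>

definition varphi ::
  "real ^ 'q \<Rightarrow> real ^ 'n ^ 'm \<Rightarrow> real ^ 'p ^ 'm \<Rightarrow> real ^ 'q ^ 'm \<Rightarrow> real ^ 'm
    \<Rightarrow> (real ^ 'q) set \<Rightarrow> real ^ 'n \<Rightarrow> real ^ 'p \<Rightarrow> real" where
  "varphi d2 A B1 B2 h Y2 x y1 =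
     (GREATEST v. \<exists>y2\<in>feasible2 A B1 B2 h Y2 x y1. v = d2 \<bullet> y2)"

text \<open>In the following definitions \<open>V\<close> stands for the function \<open>varphi d2 A B1 B2 h Y2\<close>.\<close>

definition phi ::
  "real ^ 'p \<Rightarrow> (real ^ 'p) set \<Rightarrow> (real ^ 'n \<Rightarrow> real ^ 'p \<Rightarrow> real) \<Rightarrow> real ^ 'n \<Rightarrow> real" where
  "phi d1 Y1 V x = (GREATEST v. \<exists>y1\<in>Y1. v = d1 \<bullet> y1 + V x y1)"

definition quasi_submodular ::
  "(real ^ 'p) set \<Rightarrow> (real ^ 'n \<Rightarrow> real ^ 'p \<Rightarrow> real) \<Rightarrow> bool" where
  "quasi_submodular Y1 V \<longleftrightarrow> (\<forall>y1\<in>Y1. submodular (\<lambda>x. V x y1))"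

text \<open>A permutation of the index set is given by the sequence \<open>\<sigma> 1, \<dots>, \<sigma> CARD('n)\<close> of its values,
  so \<open>\<sigma> ` {1..k}\<close> is the set of the first \<open>k\<close> indices.\<close>

definition cut_rhs ::
  "real ^ 'p \<Rightarrow> (real ^ 'n \<Rightarrow> real ^ 'p \<Rightarrow> real) \<Rightarrow> (nat \<Rightarrow> 'n) \<Rightarrow> real ^ 'p \<Rightarrow> real ^ 'n \<Rightarrow> real" where
  "cut_rhs d1 V \<sigma> y1 x =
     d1 \<bullet> y1 + V (ind_vec {}) y1
     + (\<Sum>k = 1..CARD('n). (V (ind_vec (\<sigma> ` {1..k})) y1 - V (ind_vec (\<sigma> ` {1..k - 1})) y1) * x $ \<sigma> k)"

end

theory Submission
  imports Defs
begin

text \<open>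
  For fixed \<open>yhat\<close> the right-hand side is \<open>d1 \<bullet> yhat\<close> plus the extended polymatroid (greedy)
  inequality of the submodular function \<open>f = varphi(_, yhat)\<close>. Let \<open>P m\<close> be the set of the first
  \<open>m\<close> indices in the order \<open>\<sigma>\<close>. By diminishing returns, the partial sum up to \<open>m\<close> is at most
  \<open>f (X \<inter> P m)\<close>, where \<open>X\<close> is the support of \<open>x\<close>; and if \<open>X\<close> is an initial segment of the order,
  then \<open>X \<inter> P m = P m\<close> as long as the summands do not vanish, so every step is an equality.
  Finally \<open>d1 \<bullet> yhat + f x \<le> phi x\<close>, with equality at \<open>x = z\<close> by the choice of \<open>yhat\<close>.
\<close>

lemma ind_vec_in_binary_cube: "ind_vec S \<in> binary_cube"
  by (simp add: ind_vec_def binary_cube_def)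

lemma binary_cube_eq_ind_vec:
  assumes "x \<in> binary_cube"
  shows "x = ind_vec {i. x $ i = 1}"
  using assms by (auto simp: vec_eq_iff ind_vec_def binary_cube_def)

lemma sup_ind_vec: "sup (ind_vec S) (ind_vec T) = ind_vec (S \<union> T)"
  by (auto simp: vec_eq_iff ind_vec_def sup_vec_def sup_real_def)

lemma inf_ind_vec: "inf (ind_vec S) (ind_vec T) = ind_vec (S \<inter> T)"
  by (auto simp: vec_eq_iff ind_vec_def inf_vec_def inf_real_def)

text \<open>Join and meet of 0/1 vectors are union and intersection of supports, so submodularity
  can be used for set functions from here on.\<close>

lemma submodular_ind_vec:
  assumes "submodular f"
  shows "f (ind_vec (S \<union> T)) + f (ind_vec (S \<inter> T)) \<le> f (ind_vec S) + f (ind_vec T)"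
  using assms ind_vec_in_binary_cube
  unfolding submodular_def by (metis sup_ind_vec inf_ind_vec)

lemma submodular_greedy_le:
  fixes f :: "real ^ 'n \<Rightarrow> real" and \<sigma> :: "nat \<Rightarrow> 'n"
  assumes sub: "submodular f" and inj: "inj_on \<sigma> {1..m}"
  shows "f (ind_vec {}) + (\<Sum>k = 1..m. (f (ind_vec (\<sigma> ` {1..k})) - f (ind_vec (\<sigma> ` {1..k - 1})))
      * ind_vec X $ \<sigma> k) \<le> f (ind_vec (X \<inter> \<sigma> ` {1..m}))"
  using inj
proof (induction m)
  case 0
  show ?case by simp
next
  case (Suc m)
  let ?P = "\<lambda>k. \<sigma> ` {1..k}"
  have P_Suc: "?P (Suc m) = insert (\<sigma> (Suc m)) (?P m)"
    by (simp add: atLeastAtMostSuc_conv)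
  have new: "\<sigma> (Suc m) \<notin> ?P m"
    using Suc.prems by (simp add: atLeastAtMostSuc_conv)
  have "inj_on \<sigma> {1..m}"
    using Suc.prems by (rule inj_on_subset) simp
  note IH = Suc.IH[OF this]
  show ?case
  proof (cases "\<sigma> (Suc m) \<in> X")
    case True
    \<comment> \<open>Submodularity for this pair says that adding \<open>\<sigma> (Suc m)\<close>
      to \<open>?P m\<close> gains at most what adding it to the smaller set
      \<open>X \<inter> ?P m\<close> gains. Injectivity enters through \<open>new\<close>: the added
      index must lie outside \<open>?P m\<close>.\<close>
    have "X \<inter> ?P (Suc m) \<union> ?P m = ?P (Suc m)" "X \<inter> ?P (Suc m) \<inter> ?P m = X \<inter> ?P m"
      unfolding P_Suc using True new by blast+
    then have "f (ind_vec (?P (Suc m))) + f (ind_vec (X \<inter> ?P m))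
        \<le> f (ind_vec (X \<inter> ?P (Suc m))) + f (ind_vec (?P m))"
      using submodular_ind_vec[OF sub, of "X \<inter> ?P (Suc m)" "?P m"] by simp
    then show ?thesis
      using IH True by (simp add: ind_vec_def)
  next
    case False
    then have "X \<inter> ?P (Suc m) = X \<inter> ?P m"
      unfolding P_Suc by blast
    then show ?thesis
      using IH False by (simp add: ind_vec_def)
  qed
qed

lemma greedy_eq_if_initial_segment:
  fixes f :: "real ^ 'n \<Rightarrow> real" and \<sigma> :: "nat \<Rightarrow> 'n"
  assumes initial: "\<And>j k. \<lbrakk>1 \<le> j; j \<le> k; k \<le> m; \<sigma> k \<in> X\<rbrakk> \<Longrightarrow> \<sigma> j \<in> X"
  shows "f (ind_vec {}) + (\<Sum>k = 1..m. (f (ind_vec (\<sigma> ` {1..k})) - f (ind_vec (\<sigma> ` {1..k - 1})))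
      * ind_vec X $ \<sigma> k) = f (ind_vec (X \<inter> \<sigma> ` {1..m}))"
  using initial
proof (induction m)
  case 0
  show ?case by simp
next
  case (Suc m)
  let ?P = "\<lambda>k. \<sigma> ` {1..k}"
  have P_Suc: "?P (Suc m) = insert (\<sigma> (Suc m)) (?P m)"
    by (simp add: atLeastAtMostSuc_conv)
  have IH: "f (ind_vec {}) + (\<Sum>k = 1..m. (f (ind_vec (?P k)) - f (ind_vec (?P (k - 1))))
      * ind_vec X $ \<sigma> k) = f (ind_vec (X \<inter> ?P m))"
    using Suc.prems by (intro Suc.IH) (meson le_SucI)
  show ?case
  proof (cases "\<sigma> (Suc m) \<in> X")
    case True
    \<comment> \<open>All earlier indices lie in \<open>X\<close> too, so intersecting with
      \<open>X\<close> changes nothing and the new summand telescopes. In the other case it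
      vanishes.\<close>
    then have "?P (Suc m) \<subseteq> X"
      using Suc.prems[of _ "Suc m"] by auto
    then have "X \<inter> ?P (Suc m) = ?P (Suc m)" "X \<inter> ?P m = ?P m"
      using P_Suc by auto
    then show ?thesis
      using IH True by (simp add: ind_vec_def)
  next
    case False
    then have "X \<inter> ?P (Suc m) = X \<inter> ?P m"
      unfolding P_Suc by blast
    then show ?thesis
      using IH False by (simp add: ind_vec_def)
  qed
qed

lemma cut_rhs_le:
  fixes V :: "real ^ 'n \<Rightarrow> real ^ 'p \<Rightarrow> real"
  assumes sub: "submodular (\<lambda>x. V x y1)" and perm: "bij_betw \<sigma> {1..CARD('n)} UNIV"
    and x: "x \<in> binary_cube"
  shows "cut_rhs d1 V \<sigma> y1 x \<le> d1 \<bullet> y1 + V x y1"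
proof -
  define X where "X = {i. x $ i = 1}"
  have x_eq: "x = ind_vec X"
    unfolding X_def using x by (rule binary_cube_eq_ind_vec)
  have inj: "inj_on \<sigma> {1..CARD('n)}" and surj: "\<sigma> ` {1..CARD('n)} = UNIV"
    using perm by (auto simp: bij_betw_def)
  show ?thesis
    using submodular_greedy_le[OF sub inj, of X] unfolding cut_rhs_def x_eq surj by simp
qed

lemma cut_rhs_eq_if_sorted:
  fixes V :: "real ^ 'n \<Rightarrow> real ^ 'p \<Rightarrow> real"
  assumes perm: "bij_betw \<sigma> {1..CARD('n)} UNIV" and z: "z \<in> binary_cube"
    and sorted: "\<And>k. 1 \<le> k \<Longrightarrow> k < CARD('n) \<Longrightarrow> z $ \<sigma> k \<ge> z $ \<sigma> (k + 1)"
  shows "cut_rhs d1 V \<sigma> y1 z = d1 \<bullet> y1 + V z y1"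
proof -
  define Z where "Z = {i. z $ i = 1}"
  have z_eq: "z = ind_vec Z"
    unfolding Z_def using z by (rule binary_cube_eq_ind_vec)
  have surj: "\<sigma> ` {1..CARD('n)} = UNIV"
    using perm by (auto simp: bij_betw_def)
  have initial: "\<sigma> j \<in> Z" if "1 \<le> j" "j \<le> k" "k \<le> CARD('n)" "\<sigma> k \<in> Z" for j k
    \<comment> \<open>Induction on \<open>k\<close> with \<open>j\<close> fixed. The facts about
      \<open>k\<close> are chained in so that they become premises of the induction claim. Each step
      moves membership from \<open>\<sigma> (Suc n)\<close> down to \<open>\<sigma> n\<close>: a 0/1
      entry that is at least 1 equals 1.\<close>
    using \<open>j \<le> k\<close> that(3,4)
  proof (induction rule: dec_induct)
    case base
    then show ?case by simp
  next
    case (step n)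
    then have "z $ \<sigma> n \<ge> z $ \<sigma> (n + 1)"
      using \<open>1 \<le> j\<close> by (intro sorted) auto
    then have "\<sigma> n \<in> Z"
      using step.prems unfolding z_eq by (auto simp: ind_vec_def split: if_splits)
    then show ?case
      using step by simp
  qed
  show ?thesis
    using greedy_eq_if_initial_segment[of "CARD('n)" \<sigma> Z "\<lambda>x. V x y1", OF initial]
    unfolding cut_rhs_def z_eq surj by simp
qed

text \<open>A maximiser witnesses that the \<open>GREATEST\<close> in \<open>phi\<close> exists, and
  its objective value bounds all others.\<close>

lemma phi_eq_if_is_arg_max:
  assumes "is_arg_max (\<lambda>y1. d1 \<bullet> y1 + V x y1) (\<lambda>y1. y1 \<in> Y1) y"
  shows "phi d1 Y1 V x = d1 \<bullet> y + V x y"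
  unfolding phi_def
  using assms by (intro Greatest_equality) (auto simp: is_arg_max_linorder)

theorem proposition10:
  fixes d1 :: "real ^ 'p" and d2 :: "real ^ 'q"
    and A :: "real ^ 'n ^ 'm" and B1 :: "real ^ 'p ^ 'm" and B2 :: "real ^ 'q ^ 'm"
    and h :: "real ^ 'm"
    and Y1 :: "(real ^ 'p) set" and Y2 :: "(real ^ 'q) set"
    and z :: "real ^ 'n" and yhat :: "real ^ 'p" and \<sigma> :: "nat \<Rightarrow> 'n"
  assumes varphi_max: "\<And>x y1. x \<in> binary_cube \<Longrightarrow> y1 \<in> Y1 \<Longrightarrow>
      \<exists>y2. is_arg_max (\<lambda>y2. d2 \<bullet> y2) (\<lambda>y2. y2 \<in> feasible2 A B1 B2 h Y2 x y1) y2"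
    and phi_max: "\<And>x. x \<in> binary_cube \<Longrightarrow>
      \<exists>y1. is_arg_max (\<lambda>y1. d1 \<bullet> y1 + varphi d2 A B1 B2 h Y2 x y1) (\<lambda>y1. y1 \<in> Y1) y1"
    and quasi_submod: "quasi_submodular Y1 (varphi d2 A B1 B2 h Y2)"
    and z: "z \<in> binary_cube"
    and yhat: "is_arg_max (\<lambda>y1. d1 \<bullet> y1 + varphi d2 A B1 B2 h Y2 z y1) (\<lambda>y1. y1 \<in> Y1) yhat"
    and perm: "bij_betw \<sigma> {1..CARD('n)} UNIV"
    and sorted: "\<And>k. 1 \<le> k \<Longrightarrow> k < CARD('n) \<Longrightarrow> z $ \<sigma> k \<ge> z $ \<sigma> (k + 1)"
  shows "(\<forall>x\<in>binary_cube. cut_rhs d1 (varphi d2 A B1 B2 h Y2) \<sigma> yhat x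
            \<le> phi d1 Y1 (varphi d2 A B1 B2 h Y2) x)
       \<and> (\<exists>x\<in>binary_cube. cut_rhs d1 (varphi d2 A B1 B2 h Y2) \<sigma> yhat x
            = phi d1 Y1 (varphi d2 A B1 B2 h Y2) x)"
proof -
  let ?V = "varphi d2 A B1 B2 h Y2"
  have yhat_in: "yhat \<in> Y1"
    using yhat by (simp add: is_arg_max_def)
  have "cut_rhs d1 ?V \<sigma> yhat x \<le> phi d1 Y1 ?V x" if x: "x \<in> binary_cube" for x
  proof -
    \<comment> \<open>The maximiser at \<open>x\<close> may differ from \<open>yhat\<close>, which
      is optimal at \<open>z\<close>; it is what gives \<open>phi\<close> its value at
      \<open>x\<close>.\<close>
    obtain y where y: "is_arg_max (\<lambda>y1. d1 \<bullet> y1 + ?V x y1) (\<lambda>y1. y1 \<in> Y1) y"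
      using phi_max[OF x] by blast
    have "submodular (\<lambda>x. ?V x yhat)"
      using quasi_submod yhat_in by (simp add: quasi_submodular_def)
    then have "cut_rhs d1 ?V \<sigma> yhat x \<le> d1 \<bullet> yhat + ?V x yhat"
      using perm x by (rule cut_rhs_le)
    also have "\<dots> \<le> d1 \<bullet> y + ?V x y"
      using y yhat_in by (simp add: is_arg_max_linorder)
    also have "\<dots> = phi d1 Y1 ?V x"
      using phi_eq_if_is_arg_max[where V = ?V, OF y] by simp
    finally show ?thesis .
  qed
  moreover have "cut_rhs d1 ?V \<sigma> yhat z = phi d1 Y1 ?V z"
    using cut_rhs_eq_if_sorted[OF perm z sorted] phi_eq_if_is_arg_max[where V = ?V, OF yhat] by simp
  ultimately show ?thesis
    using z by blast
qed

end
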